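(* For every non-negative integer $k$ there exists a hamiltonian-connected graph on $n=16+6k$ vertices that, for each $i \in \{4,6,8,\ldots,10+4k\}$ (all even integers from $4$ to $10+4k$), does not satisfy $\mathfrak{P}_{i}$; i.e. $\mathfrak{P}_i$ fails for a number of values $i$ in the interval $\frac n2+1\le i\le n$ that is linear in the order $n$ of the graph.
   Context: All graphs are finite and simple. A graph has property $\mathfrak{P}_i$ if for any two distinct vertices $u$ and $v$ there is a path between $u$ and $v$ with exactly $i$ vertices (i.e. of length $i-1$). A graph on $n$ vertices is hamiltonian-connected if it has $\mathfrak{P}_n$. The Faudree-Schelp Conjecture asserts that a hamiltonian-connected graph on $n$ vertices satisfies $\mathfrak{P}_i$ for all integers $i$ with $\frac n2+1\le i\le n$. *)

theory Defs
  imports Complex_Main "Graph_Theory.Graph_Theory"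
begin

text \<open>
  A finite simple graph is a symmetric loop-free finite digraph whose arcs are ordered pairs
  of vertices (\<^locale>\<open>pair_graph\<close>). The parameter \<open>i\<close> below counts the vertices of the path,
  not its edges.
\<close>

definition path_property :: "'a pair_pre_digraph \<Rightarrow> nat \<Rightarrow> bool" where
  "path_property G i \<longleftrightarrow>
     (\<forall>u \<in> pverts G. \<forall>v \<in> pverts G. u \<noteq> v \<longrightarrow>
        (\<exists>p. vpath p (with_proj G) \<and> hd p = u \<and> last p = v \<and> length p = i))"

definition hamiltonian_connected :: "'a pair_pre_digraph \<Rightarrow> bool" where
  "hamiltonian_connected G \<longleftrightarrow> path_property G (card (pverts G))"

end

theory Submission
  imports Defs "HOL-Library.Multiset"
begin

text \<open>
  The graph consists of layers \<open>0, \<dots>, M\<close> with \<open>M = 5 + 2k\<close>, of sizes \<open>2, 3, \<dots>, 3, 2\<close>.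
  Consecutive layers are completely joined, and besides these edges there is only one edge inside
  layer \<open>0\<close> and one inside layer \<open>M\<close>. Take the two vertices of layer \<open>0\<close>. A path between them that
  does not use the edge inside layer \<open>M\<close> alternates between even and odd layers, so it has an odd
  number of vertices (or is the edge inside layer \<open>0\<close>); a path that uses it runs through all layers
  and back, so it has at least \<open>2(M + 1) = 12 + 4k\<close> vertices.

  Vertices of the same layer are interchangeable, so a hamiltonian path is the same as a word over
  the layers which steps along the edges and takes each layer as often as its size. Such words are
  built by induction on \<open>k\<close>, inserting two layers into a gap that the word crosses one to three
  times: each crossing runs through the two new layers, and the first one zigzags to use up the
  rest. For the induction to go on, such a gap is kept in each of the three segments into which
  the layers of the end points divide \<open>{0..M}\<close>; one of them is always long enough.
\<close>

section \<open>Layer words\<close>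

definition layer_step :: "nat \<Rightarrow> nat \<Rightarrow> nat \<Rightarrow> bool" where
  "layer_step M a b \<longleftrightarrow> a = Suc b \<or> b = Suc a \<or> a = b \<and> (a = 0 \<or> a = M)"

definition layer_size :: "nat \<Rightarrow> nat \<Rightarrow> nat" where
  "layer_size M j = (if j = 0 \<or> j = M then 2 else 3)"

definition layer_word :: "nat \<Rightarrow> nat \<Rightarrow> nat \<Rightarrow> nat list \<Rightarrow> bool" where
  "layer_word M s t w \<longleftrightarrow> w \<noteq> [] \<and> hd w = s \<and> last w = t \<and> successively (layer_step M) w \<and>
     set w \<subseteq> {..M} \<and> (\<forall>j\<in>{..M}. count_list w j = layer_size M j)"

fun crossings :: "nat \<Rightarrow> nat list \<Rightarrow> nat" where
  "crossings g [] = 0"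
| "crossings g [a] = 0"
| "crossings g (a # b # w) =
     (if a = g \<and> b = Suc g \<or> a = Suc g \<and> b = g then 1 else 0) + crossings g (b # w)"

definition shift :: "nat \<Rightarrow> nat \<Rightarrow> nat" where
  "shift g a = (if a \<le> g then a else a + 2)"

text \<open>Inserts two layers behind layer \<open>g\<close>; each of them is then visited once per crossing.\<close>
fun stretch :: "nat \<Rightarrow> nat list \<Rightarrow> nat list" where
  "stretch g [] = []"
| "stretch g [a] = [shift g a]"
| "stretch g (a # b # w) = shift g a #
     (if a = g \<and> b = Suc g then [Suc g, Suc (Suc g)]
      else if a = Suc g \<and> b = g then [Suc (Suc g), Suc g] else []) @ stretch g (b # w)"

section \<open>Effect of inserting two layers on steps, visits and crossings\<close>

lemma crossings_append:
  "crossings g (xs @ y # ys) = crossings g (xs @ [y]) + crossings g (y # ys)"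
  by (induction xs rule: induct_list012) auto

lemma crossings_split:
  "0 < crossings g w \<Longrightarrow> \<exists>u a b v. w = u @ a # b # v \<and> {a, b} = {g, Suc g}"
proof (induction g w rule: crossings.induct)
  case (3 g a b w)
  show ?case
  proof (cases "{a, b} = {g, Suc g}")
    case True
    then show ?thesis by (intro exI[of _ "[]"]) auto
  next
    case False
    then have "0 < crossings g (b # w)"
      using 3(2) by (auto split: if_splits)
    then obtain u c d v where "b # w = u @ c # d # v \<and> {c, d} = {g, Suc g}"
      using 3(1) by blast
    then have "a # b # w = (a # u) @ c # d # v \<and> {c, d} = {g, Suc g}" by simp
    then show ?thesis by blast
  qed
qed auto

lemma stretch_Cons_neq_Nil [simp]: "stretch g (a # w) \<noteq> []"
  by (cases w) auto

lemma hd_stretch: "w \<noteq> [] \<Longrightarrow> hd (stretch g w) = shift g (hd w)"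
  by (cases "(g, w)" rule: stretch.cases) auto

lemma last_stretch: "w \<noteq> [] \<Longrightarrow> last (stretch g w) = shift g (last w)"
  by (induction g w rule: stretch.induct) auto

lemma stretch_Cons: obtains v where "stretch g (b # w) = shift g b # v"
  using hd_stretch[of "b # w" g] stretch_Cons_neq_Nil[of g b w]
  by (cases "stretch g (b # w)") auto

lemma successively_stretch:
  "g < M \<Longrightarrow> successively (layer_step M) w \<Longrightarrow> successively (layer_step (M + 2)) (stretch g w)"
proof (induction g w rule: stretch.induct)
  case (3 g a b w)
  obtain v where v: "stretch g (b # w) = shift g b # v"
    by (rule stretch_Cons)
  have IH: "successively (layer_step (M + 2)) (shift g b # v)" and ab: "layer_step M a b"
    using 3 by (simp_all add: v)
  consider "a = g \<and> b = Suc g" | "a = Suc g \<and> b = g"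
    | "\<not> (a = g \<and> b = Suc g)" "\<not> (a = Suc g \<and> b = g)" by blast
  then show ?case
  proof cases
    case 3
    \<comment> \<open>A step that does not cross the gap stays on one side of it, so
      \<open>shift\<close> moves both its ends equally. As \<open>g < M\<close>, layer
      \<open>M\<close> goes to \<open>M + 2\<close>, so repetitions of an end layer stay
      legal.\<close>
    then have ab_g: "a \<le> g \<longleftrightarrow> b \<le> g"
      using ab by (auto simp: layer_step_def)
    then have "layer_step (M + 2) (shift g a) (shift g b)"
      using ab \<open>g < M\<close> by (auto simp: layer_step_def shift_def)
    then show ?thesis using IH 3 by (auto simp: v)
  qed (use IH v in \<open>auto simp: shift_def layer_step_def\<close>)
qed auto

lemma set_stretch: "g < M \<Longrightarrow> set w \<subseteq> {..M} \<Longrightarrow> set (stretch g w) \<subseteq> {..M + 2}"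
  by (induction g w rule: stretch.induct) (auto simp: shift_def)

text \<open>Writing the last case as \<open>h' + 2\<close> avoids truncated subtraction. It includes
  \<open>h = g + 2\<close>, with \<open>h' = g\<close>.\<close>

lemma gap_cases:
  fixes g h :: nat
  obtains (low) "h \<le> g" | (mid) "h = Suc g" | (high) h' where "h = h' + 2" "g \<le> h'"
proof -
  have "h \<le> g \<or> h = Suc g \<or> h = h - 2 + 2 \<and> g \<le> h - 2" by linarith
  then show ?thesis using that by blast
qed

lemma count_list_stretch:
  "count_list (stretch g w) j =
     (if j \<le> g then count_list w j
      else if j = Suc g \<or> j = Suc (Suc g) then crossings g w else count_list w (j - 2))"
proof (induction g w rule: stretch.induct)
  case (2 g a)
  show ?case by (cases rule: gap_cases[of j g]) (simp_all add: shift_def)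
next
  case (3 g a b w)
  let ?e = "a = g \<and> b = Suc g \<or> a = Suc g \<and> b = g"
  let ?n = "\<lambda>P. if P then 1 else 0 :: nat"
  have cons: "count_list (x # xs) i = ?n (x = i) + count_list xs i" for x i and xs :: "nat list"
    by simp
  have stretch: "count_list (stretch g (a # b # w)) j =
      ?n (shift g a = j) + ?n (?e \<and> (j = Suc g \<or> j = Suc (Suc g))) + count_list (stretch g (b # w)) j"
    unfolding stretch.simps count_list_append cons by simp
  show ?case
  proof (cases rule: gap_cases[of j g])
    case low
    then have "shift g a = j \<longleftrightarrow> a = j" by (auto simp: shift_def)
    with low show ?thesis unfolding stretch 3 cons[of a] by simp
  next
    case mid
    then have "shift g a \<noteq> j" by (auto simp: shift_def)
    with mid show ?thesis unfolding stretch 3 crossings.simps by simp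
  next
    case (high j')
    \<comment> \<open>For \<open>j' = g\<close>, layer \<open>j\<close> is the second new layer,
      which no shifted layer hits.\<close>
    then have "shift g a = j \<longleftrightarrow> g < j' \<and> a = j'" by (auto simp: shift_def)
    with high show ?thesis unfolding stretch 3 crossings.simps cons[of a] by simp
  qed
qed simp

text \<open>Gap \<open>g\<close> turns into the three gaps \<open>g\<close>, \<open>g + 1\<close>
  and \<open>g + 2\<close>, each crossed as often as \<open>g\<close> was. The third falls under the
  last branch, where \<open>h - 2 = g\<close>.\<close>

lemma crossings_stretch:
  assumes "successively (layer_step M) w"
  shows "crossings h (stretch g w) =
    (if h \<le> g then crossings h w else if h = Suc g then crossings g w else crossings (h - 2) w)"
  using assms
proof (induction g w rule: stretch.induct)
  case (3 g a b w)
  obtain v where v: "stretch g (b # w) = shift g b # v"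
    by (rule stretch_Cons)
  have IH: "crossings h (shift g b # v) = (if h \<le> g then crossings h (b # w)
      else if h = Suc g then crossings g (b # w) else crossings (h - 2) (b # w))"
    and ab: "layer_step M a b"
    using 3 by (simp_all add: v)
  note h_cases = gap_cases[of h g]
  consider "a = g" "b = Suc g" | "a = Suc g" "b = g"
    | "\<not> (a = g \<and> b = Suc g)" "\<not> (a = Suc g \<and> b = g)" by blast
  then show ?case
  proof cases
    case 1
    then have "stretch g (a # b # w) = g # Suc g # Suc (Suc g) # Suc (Suc (Suc g)) # v"
      and "shift g b = Suc (Suc (Suc g))"
      using v by (simp_all add: shift_def)
    then show ?thesis using IH 1 by (cases rule: h_cases) simp_all
  next
    case 2
    then have "stretch g (a # b # w) = Suc (Suc (Suc g)) # Suc (Suc g) # Suc g # g # v"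
      and "shift g b = g"
      using v by (simp_all add: shift_def)
    then show ?thesis using IH 2 by (cases rule: h_cases) simp_all
  next
    case 3
    then have ab_g: "a \<le> g \<longleftrightarrow> b \<le> g"
      using ab by (auto simp: layer_step_def)
    let ?c = "\<lambda>h a b. a = h \<and> b = Suc h \<or> a = Suc h \<and> b = h"
    have cross: "?c h (shift g a) (shift g b) \<longleftrightarrow> (if h \<le> g then ?c h a b
        else if h = Suc g then ?c g a b else ?c (h - 2) a b)"
      using ab_g 3 by (cases rule: h_cases) (auto simp: shift_def)
    have "stretch g (a # b # w) = shift g a # shift g b # v"
      using 3 v by auto
    then have "crossings h (stretch g (a # b # w)) =
        (if ?c h (shift g a) (shift g b) then 1 else 0) + crossings h (shift g b # v)"
      by simp
    also have "\<dots> = (if h \<le> g then crossings h (a # b # w)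
        else if h = Suc g then crossings g (a # b # w) else crossings (h - 2) (a # b # w))"
      unfolding cross IH crossings.simps
      by (cases "h \<le> g"; cases "h = Suc g") (simp_all only: if_True if_False simp_thms)
    finally show ?thesis .
  qed
qed auto

section \<open>Zigzags that fill up the new layers\<close>

lemma pad_crossing:
  assumes "successively (layer_step M) w" "0 < crossings p w"
  shows "\<exists>w'. w' \<noteq> [] \<and> hd w' = hd w \<and> last w' = last w \<and> successively (layer_step M) w' \<and>
    set w' = set w \<and>
    (\<forall>j. count_list w' j = count_list w j + (if j = p \<or> j = Suc p then n else 0)) \<and>
    (\<forall>h. h \<noteq> p \<longrightarrow> crossings h w' = crossings h w)"
proof -
  obtain u a b v where w: "w = u @ a # b # v" and ab: "{a, b} = {p, Suc p}"
    using crossings_split[OF assms(2)] by blast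
  have ab': "a = p \<and> b = Suc p \<or> a = Suc p \<and> b = p"
    using ab by (auto simp: doubleton_eq_iff)
  \<comment> \<open>The crossing \<open>a, b\<close> is repeated \<open>n\<close> more times. The
    steps back from \<open>b\<close> to \<open>a\<close> also cross gap \<open>p\<close>, so each
    repetition adds one visit to \<open>p\<close> and one to \<open>Suc p\<close> and leaves all
    other gaps alone.\<close>
  define z where "z n = concat (replicate n [a, b]) @ a # b # v" for n
  have z0: "z 0 = a # b # v" and zS: "z (Suc n) = a # b # z n" for n
    by (simp_all add: z_def)
  have zhd: "\<exists>v'. z n = a # v'" for n by (cases n) (auto simp: z0 zS)
  have suc: "successively (layer_step M) (z n)" for n
  proof (induction n)
    case 0
    then show ?case using assms(1) by (simp add: z0 w successively_append_iff)
  next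
    case (Suc n)
    then show ?case using ab' zhd[of n] by (auto simp: zS layer_step_def)
  qed
  have set: "set (z n) = set (a # b # v)" for n
    by (induction n) (auto simp: z0 zS)
  have last: "last (z n) = last (a # b # v)" for n
    using zhd[of n] by (induction n) (auto simp: z0 zS z_def)
  have count: "count_list (z n) j = count_list (a # b # v) j + (if j = p \<or> j = Suc p then n else 0)" for j n
  proof (induction n)
    case (Suc n)
    have "count_list (z (Suc n)) j = count_list (z n) j + (if j = p \<or> j = Suc p then 1 else 0)"
      using ab' by (auto simp: zS)
    then show ?case unfolding Suc by simp
  qed (simp add: z0)
  have cross: "crossings h (z n) = crossings h (a # b # v)" if "h \<noteq> p" for h n
  proof (induction n)
    case (Suc n)
    obtain v' where "z n = a # v'" using zhd by blast
    then have "crossings h (z (Suc n)) = crossings h (z n)"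
      using ab' that by (auto simp: zS)
    then show ?case unfolding Suc .
  qed (simp add: z0)
  obtain v' where v': "z n = a # v'" using zhd by blast
  show ?thesis
  proof (intro exI[of _ "u @ z n"] conjI allI impI)
    show "u @ z n \<noteq> []" "hd (u @ z n) = hd w" "set (u @ z n) = set w"
      using set[of n] v' by (auto simp: w hd_append)
    show "last (u @ z n) = last w" using last[of n] v' by (simp add: w)
    show "successively (layer_step M) (u @ z n)"
      using suc[of n] assms(1) v' by (auto simp: w successively_append_iff)
    show "count_list (u @ z n) j = count_list w j + (if j = p \<or> j = Suc p then n else 0)" for j
      using count[of n j] by (simp add: w)
    show "crossings h (u @ z n) = crossings h w" if "h \<noteq> p" for h
      using cross[of h n] that v' crossings_append[of h u a v'] crossings_append[of h u a "b # v"]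
      by (simp add: w)
  qed
qed

text \<open>\<open>stretch\<close> gives each new layer as many visits as \<open>g\<close> has
  crossings, and a zigzag between the two new layers supplies what is missing to 3; hence the range
  \<open>{1..3}\<close>. The zigzag affects only gap \<open>Suc g\<close>, so the old gap
  \<open>g\<close> survives as both \<open>g\<close> and \<open>g + 2\<close>.\<close>

lemma layer_word_insert:
  assumes w: "layer_word M s t w" and g: "g < M" and r: "crossings g w \<in> {1..3}"
  shows "\<exists>w'. layer_word (M + 2) (shift g s) (shift g t) w' \<and>
    (\<forall>h\<le>g. crossings h w' = crossings h w) \<and> (\<forall>h\<ge>g. crossings (h + 2) w' = crossings h w)"
proof -
  have suc: "successively (layer_step M) w" and ne: "w \<noteq> []" and hl: "hd w = s" "last w = t"
    and sub: "set w \<subseteq> {..M}" and cnt: "\<And>j. j \<le> M \<Longrightarrow> count_list w j = layer_size M j"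
    using w by (auto simp: layer_word_def)
  obtain w' where w': "w' \<noteq> []" "hd w' = hd (stretch g w)" "last w' = last (stretch g w)"
    "successively (layer_step (M + 2)) w'" "set w' = set (stretch g w)"
    "\<And>j. count_list w' j = count_list (stretch g w) j
       + (if j = Suc g \<or> j = Suc (Suc g) then 3 - crossings g w else 0)"
    "\<And>h. h \<noteq> Suc g \<Longrightarrow> crossings h w' = crossings h (stretch g w)"
  proof -
    have "0 < crossings (Suc g) (stretch g w)"
      using r crossings_stretch[OF suc, of "Suc g" g] by simp
    from pad_crossing[OF successively_stretch[OF g suc] this, of "3 - crossings g w"]
    show ?thesis using that by blast
  qed
  have "count_list w' j = layer_size (M + 2) j" if "j \<le> M + 2" for j
  proof -
    consider "j \<le> g" | "j = Suc g \<or> j = Suc (Suc g)" | "Suc (Suc g) < j" by linarith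
    then show ?thesis
    proof cases
      case 3
      then have "j - 2 \<le> M" "j \<noteq> 0" "j - 2 \<noteq> 0" "j - 2 = M \<longleftrightarrow> j = M + 2" using that by auto
      then show ?thesis using 3 cnt[of "j - 2"] w'(6)[of j]
        by (simp add: count_list_stretch layer_size_def)
    qed (use g r cnt[of j] w'(6)[of j] in \<open>auto simp: count_list_stretch layer_size_def\<close>)
  qed
  then have "layer_word (M + 2) (shift g s) (shift g t) w'"
    using w'(1-5) set_stretch[OF g sub] hl by (simp add: layer_word_def hd_stretch last_stretch ne)
  moreover have "crossings h w' = crossings h w" if "h \<le> g" for h
    using w'(7)[of h] crossings_stretch[OF suc, of h g] that by simp
  moreover have "crossings (h + 2) w' = crossings h w" if "g \<le> h" for h
    using w'(7)[of "h + 2"] crossings_stretch[OF suc, of "h + 2" g] that by simp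
  ultimately show ?thesis by (intro exI[of _ w'] conjI allI impI) simp_all
qed

section \<open>Induction on the number of layers\<close>

definition has_gap :: "nat list \<Rightarrow> nat \<Rightarrow> nat \<Rightarrow> bool" where
  "has_gap w a b \<longleftrightarrow> a < b \<longrightarrow> (\<exists>g\<in>{a..<b}. crossings g w \<in> {1..3})"

text \<open>Words for \<open>M = 5\<close> and all pairs of end layers, found by computer search.\<close>
definition base_words :: "nat list list" where
  "base_words =
   [[0,1,2,1,2,3,4,3,4,5,5,4,3,2,1,0],
    [0,0,1,2,1,2,3,4,3,4,5,5,4,3,2,1],
    [0,1,0,1,2,1,2,3,4,3,4,5,5,4,3,2],
    [0,0,1,2,1,2,1,2,3,4,3,4,5,5,4,3],
    [0,1,0,1,2,1,2,3,2,3,4,3,4,5,5,4],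
    [0,0,1,2,1,2,1,2,3,4,3,4,3,4,5,5],
    [1,0,0,1,2,3,2,3,4,5,4,5,4,3,2,1],
    [1,0,0,1,2,1,2,3,4,3,4,5,5,4,3,2],
    [1,0,0,1,2,1,2,3,2,3,4,5,4,5,4,3],
    [1,0,0,1,2,1,2,3,2,3,4,3,4,5,5,4],
    [1,0,0,1,2,1,2,3,2,3,4,3,4,5,4,5],
    [2,1,0,1,0,1,2,3,4,3,4,5,5,4,3,2],
    [2,1,0,0,1,2,1,2,3,4,3,4,5,5,4,3],
    [2,1,0,1,0,1,2,3,2,3,4,3,4,5,5,4],
    [2,1,0,0,1,2,1,2,3,4,3,4,3,4,5,5],
    [3,2,1,0,0,1,2,1,2,3,4,5,4,5,4,3],
    [3,2,1,0,0,1,2,1,2,3,4,3,4,5,5,4],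
    [3,2,1,0,0,1,2,1,2,3,4,3,4,5,4,5],
    [4,3,2,1,0,1,0,1,2,3,2,3,4,5,5,4],
    [4,3,2,1,0,0,1,2,1,2,3,4,3,4,5,5],
    [5,4,3,2,1,0,0,1,2,1,2,3,4,3,4,5]]"

lemma layer_word_base_words:
  "\<forall>w\<in>set base_words. layer_word 5 (hd w) (last w) w \<and>
     has_gap w 0 (hd w) \<and> has_gap w (hd w) (last w) \<and> has_gap w (last w) 5"
proof -
  have layers: "{..5::nat} = {0, 1, 2, 3, 4, 5}" by auto
  have gap: "has_gap w a b \<longleftrightarrow> (a < b \<longrightarrow>
      (\<exists>g\<in>{0, 1, 2, 3, 4}. a \<le> g \<and> g < b \<and> 1 \<le> crossings g w \<and> crossings g w \<le> 3))"
    if "b \<in> {..5}" for a b w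
  proof -
    have "{a..<b} = {g\<in>{0, 1, 2, 3, 4}. a \<le> g \<and> g < b}" using that by auto
    then show ?thesis by (auto simp: has_gap_def)
  qed
  show ?thesis
    by (simp add: base_words_def layer_word_def layers gap layer_step_def layer_size_def)
qed

lemma ex_base_word: "s \<le> t \<Longrightarrow> t \<le> 5 \<Longrightarrow> \<exists>w\<in>set base_words. hd w = s \<and> last w = t"
proof -
  have "\<forall>t\<in>{0, 1, 2, 3, 4, 5}. \<forall>s\<in>{0, 1, 2, 3, 4, 5}. s \<le> t \<longrightarrow>
      (\<exists>w\<in>set base_words. hd w = s \<and> last w = t)"
    by (simp add: base_words_def)
  moreover assume "s \<le> t" "t \<le> 5"
  moreover from this have "t \<in> {0, 1, 2, 3, 4, 5}" "s \<in> {0, 1, 2, 3, 4, 5}" by auto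
  ultimately show ?thesis by blast
qed

text \<open>A usable gap \<open>h < g\<close> keeps its number. A usable gap
  \<open>h \<ge> g\<close> reappears as \<open>h + 2\<close>, inside the shifted segment because
  then \<open>g < b\<close>.\<close>

lemma has_gap_insert:
  assumes "has_gap w a b" "a \<le> b"
    and low: "\<forall>h\<le>g. crossings h w' = crossings h w"
    and high: "\<forall>h\<ge>g. crossings (h + 2) w' = crossings h w"
  shows "has_gap w' (shift g a) (shift g b)"
proof (cases "a < b")
  case True
  then obtain h where h: "a \<le> h" "h < b" "crossings h w \<in> {1..3}"
    using assms(1) by (auto simp: has_gap_def)
  show ?thesis
  proof (cases "h < g")
    case True
    then have "h \<in> {shift g a..<shift g b}" "crossings h w' \<in> {1..3}"
      using low h by (auto simp: shift_def)
    then show ?thesis unfolding has_gap_def by blast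
  next
    case False
    show ?thesis
    proof (cases "a \<le> g \<and> b \<le> g")
      case True
      then show ?thesis using False h by simp
    next
      case b: False
      then have "h + 2 \<in> {shift g a..<shift g b}" "crossings (h + 2) w' \<in> {1..3}"
        using False high h by (auto simp: shift_def)
      then show ?thesis unfolding has_gap_def by blast
    qed
  qed
qed (use assms(2) in \<open>simp add: has_gap_def\<close>)

text \<open>In the induction step the three segments have total length \<open>M + 2\<close>, at
  least 7, so one of them has length at least 3. An empty segment satisfies \<open>has_gap\<close>
  vacuously. The case \<open>s \<le> t\<close> suffices because paths can be reversed.\<close>

lemma ex_layer_word_gaps:
  assumes "s \<le> t" "t \<le> 5 + 2 * k"
  shows "\<exists>w. layer_word (5 + 2 * k) s t w \<and>
    has_gap w 0 s \<and> has_gap w s t \<and> has_gap w t (5 + 2 * k)"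
  using assms
proof (induction k arbitrary: s t)
  case 0
  then obtain w where w: "w \<in> set base_words" "hd w = s" "last w = t"
    using ex_base_word[of s t] by auto
  then show ?case using bspec[OF layer_word_base_words w(1)] by auto
next
  case (Suc k)
  define M where "M = 5 + 2 * k"
  have M_Suc: "5 + 2 * Suc k = M + 2" by (simp add: M_def)
  note IH = Suc.IH[folded M_def] and prems = Suc.prems[unfolded M_Suc]
  have step: "\<exists>w. layer_word (M + 2) (shift g s) (shift g t) w \<and> has_gap w 0 (shift g s) \<and>
      has_gap w (shift g s) (shift g t) \<and> has_gap w (shift g t) (M + 2)"
    if st: "s \<le> t" "t \<le> M" "g < M" "layer_word M s t w" "has_gap w 0 s" "has_gap w s t" "has_gap w t M"
      "crossings g w \<in> {1..3}" for g w s t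
  proof -
    obtain w' where w': "layer_word (M + 2) (shift g s) (shift g t) w'"
      "\<forall>h\<le>g. crossings h w' = crossings h w" "\<forall>h\<ge>g. crossings (h + 2) w' = crossings h w"
      using layer_word_insert[OF st(4,3,8)] by blast
    have "shift g 0 = 0" "shift g M = M + 2"
      using \<open>g < M\<close> by (simp_all add: shift_def)
    then show ?thesis
      using w' has_gap_insert[OF st(5) _ w'(2,3)] has_gap_insert[OF st(6) _ w'(2,3)]
        has_gap_insert[OF st(7) _ w'(2,3)] st(1,2) by auto
  qed
  \<comment> \<open>Shortening such a segment by two leaves it nonempty, so it still contains a usable gap.\<close>
  consider "3 \<le> s" | "3 \<le> t - s" | "3 \<le> M + 2 - t"
    using M_def by linarith
  then show ?case
  proof cases
    case 1
    \<comment> \<open>Layers inserted below \<open>s\<close> raise both ends by two, so the word to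
      extend runs from \<open>s - 2\<close> to \<open>t - 2\<close>. Insertion between
      \<open>s\<close> and \<open>t\<close> raises only \<open>t\<close>, and insertion above
      \<open>t\<close> raises neither.\<close>
    then have bounds: "s - 2 \<le> t - 2" "t - 2 \<le> M" using prems by auto
    then obtain w where w: "layer_word M (s - 2) (t - 2) w"
      "has_gap w 0 (s - 2)" "has_gap w (s - 2) (t - 2)" "has_gap w (t - 2) M"
      using IH[of "s - 2" "t - 2"] bounds by auto
    moreover from this obtain g where "g < s - 2" "crossings g w \<in> {1..3}"
      using 1 by (auto simp: has_gap_def)
    moreover from this have "shift g (s - 2) = s" "shift g (t - 2) = t"
      using 1 prems by (auto simp: shift_def)
    ultimately show ?thesis
      unfolding M_Suc using step[of "s - 2" "t - 2" g w] prems bounds by auto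
  next
    case 2
    then have bounds: "s \<le> t - 2" "t - 2 \<le> M" using prems by auto
    then obtain w where w: "layer_word M s (t - 2) w"
      "has_gap w 0 s" "has_gap w s (t - 2)" "has_gap w (t - 2) M"
      using IH[of s "t - 2"] bounds by auto
    moreover from this obtain g where "s \<le> g" "g < t - 2" "crossings g w \<in> {1..3}"
      using 2 by (auto simp: has_gap_def)
    moreover from this have "shift g s = s" "shift g (t - 2) = t"
      by (auto simp: shift_def)
    ultimately show ?thesis
      unfolding M_Suc using step[of s "t - 2" g w] 2 prems bounds by auto
  next
    case 3
    then have bounds: "s \<le> t" "t \<le> M" using prems by auto
    then obtain w where w: "layer_word M s t w"
      "has_gap w 0 s" "has_gap w s t" "has_gap w t M"
      using IH[of s t] bounds by auto
    moreover from this obtain g where "t \<le> g" "g < M" "crossings g w \<in> {1..3}"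
      using 3 by (auto simp: has_gap_def)
    moreover from this have "shift g s = s" "shift g t = t"
      using prems by (auto simp: shift_def)
    ultimately show ?thesis
      unfolding M_Suc using step[of s t g w] 3 prems bounds by auto
  qed
qed

section \<open>The layered graph\<close>

text \<open>With the vertices numbered from \<open>0\<close>, this makes layer \<open>0\<close> have two elements instead of three;
  the bound \<open>16 + 6k\<close> on the vertices cuts the last layer down to two as well.\<close>
definition layer :: "nat \<Rightarrow> nat" where
  "layer v = Suc v div 3"

definition layer_graph :: "nat \<Rightarrow> nat pair_pre_digraph" where
  "layer_graph k = \<lparr>pverts = {..<16 + 6 * k},
     parcs = {(u, v). u < 16 + 6 * k \<and> v < 16 + 6 * k \<and> u \<noteq> v \<and>
       layer_step (5 + 2 * k) (layer u) (layer v)}\<rparr>"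

lemma pverts_layer_graph [simp]: "pverts (layer_graph k) = {..<16 + 6 * k}"
  by (simp add: layer_graph_def)

lemma pair_graph_layer_graph: "pair_graph (layer_graph k)"
proof
  show "finite (parcs (layer_graph k))"
    by (rule finite_subset[of _ "{..<16 + 6 * k} \<times> {..<16 + 6 * k}"])
       (auto simp: layer_graph_def)
  show "symmetric (with_proj (layer_graph k))"
    unfolding symmetric_def by (auto simp: layer_graph_def layer_step_def sym_def)
qed (auto simp: layer_graph_def)

lemma card_layer:
  assumes "j \<le> 5 + 2 * k"
  shows "card {v\<in>{..<16 + 6 * k}. layer v = j} = layer_size (5 + 2 * k) j"
proof -
  \<comment> \<open>Truncated subtraction makes layer 0 start at 0, and \<open>min\<close> cuts only
    the last layer, so exactly these two have two vertices.\<close>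
  have "{v\<in>{..<16 + 6 * k}. layer v = j} = {3 * j - 1..<min (3 * j + 2) (16 + 6 * k)}"
    by (auto simp: layer_def)
  then show ?thesis using assms by (auto simp: layer_size_def min_def)
qed

section \<open>Lifting layer words to hamiltonian paths\<close>

lemma map_eq_if_image_mset_eq:
  "mset w = image_mset f N \<Longrightarrow> \<exists>p. map f p = w \<and> mset p = N"
proof (induction w arbitrary: N)
  case (Cons a w)
  then obtain x N' where x: "N = add_mset x N'" "f x = a" "image_mset f N' = mset w"
    by (metis mset.simps(2) msed_map_invR)
  then obtain p where "map f p = w \<and> mset p = N'"
    using Cons.IH by metis
  then have "map f (x # p) = a # w \<and> mset (x # p) = N" using x by simp
  then show ?case by (rule exI)
qed auto

lemma layer_word_realize:
  assumes w: "layer_word (5 + 2 * k) (layer x) (layer y) w"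
    and x: "x < 16 + 6 * k" and y: "y < 16 + 6 * k" and "x \<noteq> y"
  shows "\<exists>p. map layer p = w \<and> mset p = mset_set {..<16 + 6 * k} \<and> hd p = x \<and> last p = y"
proof -
  let ?V = "{..<16 + 6 * k}" and ?M = "5 + 2 * k"
  have mset_w: "mset w = image_mset layer (mset_set ?V)"
  proof (rule multiset_eqI)
    fix j
    have "count (image_mset layer (mset_set ?V)) j = card {v\<in>?V. layer v = j}"
      by (simp add: count_image_mset' conj_commute eq_commute[of j])
    moreover have "count_list w j = card {v\<in>?V. layer v = j}"
    proof (cases "j \<le> ?M")
      case True
      then show ?thesis using w card_layer by (simp add: layer_word_def)
    next
      case False
      then have "j \<notin> set w" "{v\<in>?V. layer v = j} = {}"
        using w by (auto simp: layer_word_def layer_def)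
      then show ?thesis by simp
    qed
    ultimately show "count (mset w) j = count (image_mset layer (mset_set ?V)) j"
      by (simp add: count_mset)
  qed
  \<comment> \<open>The prescribed ends are set aside, and the interior of the word is filled from
    the remaining vertices. As \<open>x \<noteq> y\<close>, they are two elements even within one
    layer.\<close>
  have V: "mset_set ?V = {#x, y#} + mset_set (?V - {x, y})"
    using x y \<open>x \<noteq> y\<close> mset_set.remove[of ?V x] mset_set.remove[of "?V - {x}" y]
    by (simp add: Diff_insert2[symmetric] insert_commute)
  have "size (mset w) \<ge> 2" unfolding mset_w by simp
  then obtain a w1 b where w1: "w = a # w1 @ [b]"
    by (cases w; cases "tl w" rule: rev_cases) auto
  then have ab: "a = layer x" "b = layer y" using w by (auto simp: layer_word_def)
  have "mset w1 = image_mset layer (mset_set (?V - {x, y}))"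
    using mset_w unfolding V w1 ab by simp
  then obtain p where "map layer p = w1" "mset p = mset_set (?V - {x, y})"
    using map_eq_if_image_mset_eq by metis
  then have "map layer (x # p @ [y]) = w \<and> mset (x # p @ [y]) = mset_set ?V \<and>
      hd (x # p @ [y]) = x \<and> last (x # p @ [y]) = y"
    using V w1 ab by simp
  then show ?thesis by blast
qed

lemma set_vwalk_arcs_subset_iff:
  "set (vwalk_arcs p) \<subseteq> E \<longleftrightarrow> successively (\<lambda>u v. (u, v) \<in> E) p"
  by (induction p rule: vwalk_arcs.induct) auto

text \<open>On a distinct list the condition \<open>u \<noteq> v\<close> on arcs is automatic, so
  adjacency depends on the layers alone.\<close>

lemma vpath_layer_graph_iff:
  "vpath p (with_proj (layer_graph k)) \<longleftrightarrow> p \<noteq> [] \<and> set p \<subseteq> {..<16 + 6 * k} \<and> distinct p \<and>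
     successively (layer_step (5 + 2 * k)) (map layer p)"
proof -
  have "successively (\<lambda>u v. (u, v) \<in> parcs (layer_graph k)) p \<longleftrightarrow>
      successively (layer_step (5 + 2 * k)) (map layer p)"
    if "set p \<subseteq> {..<16 + 6 * k}" "distinct p"
    using that by (induction p rule: induct_list012) (auto simp: layer_graph_def)
  then show ?thesis
    by (auto simp: vpath_def vwalk_def set_vwalk_arcs_subset_iff)
qed

lemma vpath_rev_layer_graph:
  "vpath p (with_proj (layer_graph k)) \<Longrightarrow> vpath (rev p) (with_proj (layer_graph k))"
  unfolding vpath_layer_graph_iff
  by (auto simp: rev_map[symmetric] layer_step_def elim!: successively_mono)

lemma hamiltonian_connected_layer_graph: "hamiltonian_connected (layer_graph k)"
proof -
  let ?n = "16 + 6 * k"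
  have le: "\<exists>p. vpath p (with_proj (layer_graph k)) \<and> hd p = u \<and> last p = v \<and> length p = ?n"
    if uv: "u < ?n" "v < ?n" "u \<noteq> v" "layer u \<le> layer v" for u v
  proof -
    have "layer v \<le> 5 + 2 * k" using uv by (auto simp: layer_def)
    then obtain w where w: "layer_word (5 + 2 * k) (layer u) (layer v) w"
      using ex_layer_word_gaps[OF uv(4), of k] by blast
    then obtain p where p: "map layer p = w" "mset p = mset_set {..<?n}" "hd p = u" "last p = v"
      using layer_word_realize[OF w uv(1-3)] by blast
    \<comment> \<open>A list with \<open>?n\<close> entries that covers \<open>?n\<close> vertices
      is distinct, which makes \<open>p\<close> a path.\<close>
    have "set p = {..<?n}" "length p = ?n"
      using arg_cong[OF p(2), of set_mset] arg_cong[OF p(2), of size] by simp_all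
    then have "vpath p (with_proj (layer_graph k))"
      using p w by (auto simp: vpath_layer_graph_iff layer_word_def card_distinct)
    then show ?thesis using p \<open>length p = ?n\<close> by blast
  qed
  have "\<exists>p. vpath p (with_proj (layer_graph k)) \<and> hd p = u \<and> last p = v \<and> length p = ?n"
    if uv: "u < ?n" "v < ?n" "u \<noteq> v" for u v
  proof (cases "layer u \<le> layer v")
    case False
    then obtain p where "vpath p (with_proj (layer_graph k))" "hd p = v" "last p = u" "length p = ?n"
      using le[of v u] uv by auto
    then have "vpath (rev p) (with_proj (layer_graph k)) \<and> hd (rev p) = u \<and> last (rev p) = v
        \<and> length (rev p) = ?n"
      using vpath_rev_layer_graph by (auto simp: hd_rev last_rev)
    then show ?thesis by blast
  qed (use le uv in blast)
  then show ?thesis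
    by (auto simp: hamiltonian_connected_def path_property_def)
qed

section \<open>Missing path sizes between the two vertices of layer 0\<close>

lemma not_path_property_layer_graph:
  assumes "i \<in> {4..10 + 4 * k}" "even i"
  shows "\<not> path_property (layer_graph k) i"
proof
  let ?M = "5 + 2 * k"
  assume "path_property (layer_graph k) i"
  \<comment> \<open>\<open>0\<close> and \<open>1\<close> are the two vertices of layer 0.\<close>
  then obtain p where p: "vpath p (with_proj (layer_graph k))" "hd p = 0" "last p = 1" "length p = i"
    unfolding path_property_def by (force dest: bspec[of _ _ 0] bspec[of _ _ 1])
  have i: "4 \<le> i" "i \<le> 10 + 4 * k" using assms by auto
  have d: "distinct p" and "p \<noteq> []"
    and suc: "\<And>j. Suc j < i \<Longrightarrow> layer_step ?M (layer (p ! j)) (layer (p ! Suc j))"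
    using p(1,4) unfolding vpath_layer_graph_iff successively_conv_nth by auto
  have p0: "p ! 0 = 0" and pl: "p ! (i - 1) = 1"
    using p \<open>p \<noteq> []\<close> by (auto simp: hd_conv_nth last_conv_nth)
  \<comment> \<open>Each step changes the layer by at most one, so layer \<open>?M\<close> is at
    least \<open>?M\<close> steps away from either end.\<close>
  have up: "layer (p ! j) \<le> j" if "j < i" for j
    using that
  proof (induction j)
    case (Suc j)
    then show ?case using suc[of j] by (auto simp: layer_step_def)
  qed (simp add: p0 layer_def)
  have down: "layer (p ! (i - 1 - j)) \<le> j" if "j < i" for j
    using that
  proof (induction j)
    case (Suc j)
    then have "Suc (i - 1 - Suc j) = i - 1 - j" by simp
    then show ?case using Suc suc[of "i - 1 - Suc j"] by (auto simp: layer_step_def)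
  qed (use pl in \<open>simp add: layer_def\<close>)
  have "\<exists>j. Suc j < i \<and> layer (p ! j) = layer (p ! Suc j)"
  proof (rule ccontr)
    assume no: "\<nexists>j. Suc j < i \<and> layer (p ! j) = layer (p ! Suc j)"
    have "even (layer (p ! j)) \<longleftrightarrow> even j" if "j < i" for j
      using that
    proof (induction j)
      case (Suc j)
      then show ?case using suc[of j] no by (auto simp: layer_step_def)
    qed (simp add: p0 layer_def)
    \<comment> \<open>Position \<open>i - 1\<close> is odd but holds vertex \<open>1\<close>, which
      lies in the even layer 0.\<close>
    from this[of "i - 1"] show False
      using i assms(2) unfolding pl by (simp add: layer_def)
  qed
  then obtain j where j: "Suc j < i" "layer (p ! j) = layer (p ! Suc j)" by blast
  then consider "layer (p ! j) = 0" | "layer (p ! j) = ?M"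
    using suc[of j] by (auto simp: layer_step_def)
  then show False
  proof cases
    case 1
    then have "p ! j \<in> {0, 1}" "p ! Suc j \<in> {0, 1}"
      using j(2) by (auto simp: layer_def)
    \<comment> \<open>Two consecutive positions would be the two ends of \<open>p\<close>, forcing
      \<open>i = 2\<close>.\<close>
    then have "p ! j = p ! 0 \<or> p ! j = p ! (i - 1)" "p ! Suc j = p ! 0 \<or> p ! Suc j = p ! (i - 1)"
      unfolding p0 pl by simp_all
    then show False using d j(1) i p(4)
      by (auto simp: nth_eq_iff_index_eq)
  next
    case 2
    \<comment> \<open>At least \<open>?M\<close> steps lie on either side of the repetition, so
      \<open>i\<close> is at least \<open>2 * ?M + 2 = 12 + 4 * k\<close>.\<close>
    then have "?M \<le> j" using up[of j] j by simp
    moreover have "?M \<le> i - 1 - Suc j"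
      using down[of "i - 1 - Suc j"] 2 j by simp
    ultimately show False using i by simp
  qed
qed

section \<open>Linear number of failing values\<close>

theorem theorem1:
  shows "\<exists>c::real. c > 0 \<and>
    (\<forall>k::nat. \<exists>G :: nat pair_pre_digraph.
       pair_graph G \<and>
       card (pverts G) = 16 + 6 * k \<and>
       hamiltonian_connected G \<and>
       (\<forall>i \<in> {4..10 + 4 * k}. even i \<longrightarrow> \<not> path_property G i) \<and>
       c * real (card (pverts G)) \<le>
         real (card {i::nat. real (card (pverts G)) / 2 + 1 \<le> real i \<and> i \<le> card (pverts G)
                       \<and> \<not> path_property G i}))"
proof (intro exI[of _ "1/32"] conjI allI)
  fix k :: nat
  let ?G = "layer_graph k"
  let ?S = "{i::nat. real (card (pverts ?G)) / 2 + 1 \<le> real i \<and> i \<le> card (pverts ?G)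
                       \<and> \<not> path_property ?G i}"
  \<comment> \<open>These are even numbers counted down from \<open>10 + 4 * k\<close>. For
    \<open>2 * j \<le> k\<close> they are at least \<open>10 + 3 * k\<close>, while half the order
    plus one is \<open>9 + 3 * k\<close>.\<close>
  let ?f = "\<lambda>j. 10 + 4 * k - 2 * j"
  have sub: "?f ` {..k div 2} \<subseteq> ?S"
  proof
    fix i assume "i \<in> ?f ` {..k div 2}"
    then obtain j where j: "i = ?f j" "2 * j \<le> k" by auto
    then have "9 + 3 * k \<le> i" "i \<le> 10 + 4 * k" "even i" by auto
    moreover from this have "real (9 + 3 * k) \<le> real i" by (simp only: of_nat_le_iff)
    then have "real (card (pverts ?G)) / 2 + 1 \<le> real i"
      by (simp add: field_simps)
    ultimately show "i \<in> ?S" using not_path_property_layer_graph[of i k] by auto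
  qed
  have "Suc (k div 2) = card (?f ` {..k div 2})"
    by (subst card_image) (auto simp: inj_on_def)
  also have "\<dots> \<le> card ?S"
    using sub by (rule card_mono[rotated]) (rule finite_subset[of _ "{..card (pverts ?G)}"], auto)
  finally have *: "Suc (k div 2) \<le> card ?S" .
  \<comment> \<open>The ratio of \<open>Suc (k div 2)\<close> to \<open>16 + 6 * k\<close> is
    smallest at \<open>k = 1\<close>, where it is 1/22; the constant 1/32 lies below that.\<close>
  have "1 / 32 * real (card (pverts ?G)) \<le> real (Suc (k div 2))" by simp
  also have "\<dots> \<le> real (card ?S)" using * by (rule of_nat_mono)
  finally have "1 / 32 * real (card (pverts ?G)) \<le> real (card ?S)" .
  then show "\<exists>G :: nat pair_pre_digraph.
       pair_graph G \<and>
       card (pverts G) = 16 + 6 * k \<and>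
       hamiltonian_connected G \<and>
       (\<forall>i \<in> {4..10 + 4 * k}. even i \<longrightarrow> \<not> path_property G i) \<and>
       1 / 32 * real (card (pverts G)) \<le>
         real (card {i::nat. real (card (pverts G)) / 2 + 1 \<le> real i \<and> i \<le> card (pverts G)
                       \<and> \<not> path_property G i})"
    using pair_graph_layer_graph hamiltonian_connected_layer_graph not_path_property_layer_graph
    by (intro exI[of _ ?G] conjI ballI impI) simp_all
qed simp

end
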